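(* For all non-negative integers $n,m,p,q$ and all complex numbers $z,w,\gamma$, $$H_{n,m}^{(p,q)}(z,w|\gamma)=e^{\gamma\partial_{z}^{p}\partial_{w}^{q}}\{z^{n}w^{m}\}.$$ Moreover, one has the symmetry property $$H_{n,m}^{(p,q)}(z,w|\gamma)=H_{m,n}^{(q,p)}(w,z|\gamma).$$
   Context: For non-negative integers $n,m,p,q$ and complex $z,w,\gamma$, the two-variable $(p,q)$ Gould--Hopper polynomials are $$H_{n,m}^{(p,q)}(z,w|\gamma)= n!\,m!\sum_{k=0}^{\lfloor n/p\rfloor\wedge\lfloor m/q\rfloor}\frac{\gamma^k}{k!}\frac{z^{n-pk}}{(n-pk)!}\frac{w^{m-qk}}{(m-qk)!},$$ where $a\wedge b=\min\{a,b\}$ and $\lfloor j/0\rfloor=+\infty$ by convention (so for $p=q=0$ the sum is the infinite series $e^{\gamma}z^nw^m$; in particular $H_{0,0}^{(0,0)}(z,w|\gamma)=e^\gamma$); $0^0=1$. The operator $e^{\gamma\partial_z^p\partial_w^q}$ acts on polynomials in $(z,w)$ by $e^{\gamma\partial_z^p\partial_w^q}=\sum_{k\ge 0}\frac{\gamma^k}{k!}\partial_z^{pk}\partial_w^{qk}$ (for $p+q\geq1$ only finitely many terms are nonzero on a given polynomial; for $p=q=0$ it is multiplication by $e^\gamma$). *)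

theory Defs
  imports "HOL-Analysis.Analysis" "HOL-Library.Extended_Nat"
begin

(* The floor of j/p as an extended natural number, with the convention
   that it is infinite for p = 0. *)
definition floor_quot :: "nat \<Rightarrow> nat \<Rightarrow> enat" where
  "floor_quot j p = (if p = 0 then \<infinity> else enat (j div p))"

(* The arguments are n m p q z w \<gamma>, for H_{n,m}^{(p,q)}(z,w|\<gamma>).  The index set is
   infinite exactly when p = q = 0; the summation is then a convergent series, see
   Gould_Hopper_0_0 below.  On the index set p*k \<le> n and q*k \<le> m, so the natural
   number subtractions do not truncate. *)
definition Gould_Hopper ::
  "nat \<Rightarrow> nat \<Rightarrow> nat \<Rightarrow> nat \<Rightarrow> complex \<Rightarrow> complex \<Rightarrow> complex \<Rightarrow> complex" where
  "Gould_Hopper n m p q z w \<gamma> =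
     fact n * fact m *
     (\<Sum>\<^sub>\<infinity>k\<in>{k. enat k \<le> min (floor_quot n p) (floor_quot m q)}.
        \<gamma> ^ k / fact k * (z ^ (n - p * k) / fact (n - p * k))
                     * (w ^ (m - q * k) / fact (m - q * k)))"

definition partial_z :: "(complex \<Rightarrow> complex \<Rightarrow> complex) \<Rightarrow> complex \<Rightarrow> complex \<Rightarrow> complex" where
  "partial_z f = (\<lambda>z w. deriv (\<lambda>x. f x w) z)"

definition partial_w :: "(complex \<Rightarrow> complex \<Rightarrow> complex) \<Rightarrow> complex \<Rightarrow> complex \<Rightarrow> complex" where
  "partial_w f = (\<lambda>z w. deriv (\<lambda>y. f z y) w)"

(* The operator exp(\<gamma> \<partial>_z^p \<partial>_w^q).  It is meant to be applied to polynomial functions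
   of (z,w) only: there the summation has finitely many nonzero terms if p + q \<ge> 1,
   and for p = q = 0 it is multiplication by exp \<gamma>, see exp_partial_0_0 below. *)
definition exp_partial ::
  "complex \<Rightarrow> nat \<Rightarrow> nat \<Rightarrow> (complex \<Rightarrow> complex \<Rightarrow> complex) \<Rightarrow> complex \<Rightarrow> complex \<Rightarrow> complex" where
  "exp_partial \<gamma> p q f = (\<lambda>z w.
     \<Sum>\<^sub>\<infinity>k. \<gamma> ^ k / fact k * (partial_z ^^ (p * k)) ((partial_w ^^ (q * k)) f) z w)"

lemma has_sum_exp_series: "((\<lambda>k. \<gamma> ^ k / fact k) has_sum exp \<gamma>) (UNIV :: nat set)"
  for \<gamma> :: complex
proof (rule norm_summable_imp_has_sum)
  show "summable (\<lambda>k. norm (\<gamma> ^ k / fact k))"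
    using summable_norm_exp[of \<gamma>] by (simp add: scaleR_conv_of_real field_simps)
  show "(\<lambda>k. \<gamma> ^ k / fact k) sums exp \<gamma>"
    using exp_converges[of \<gamma>] by (simp add: scaleR_conv_of_real field_simps)
qed

lemma Gould_Hopper_0_0: "Gould_Hopper n m 0 0 z w \<gamma> = exp \<gamma> * z ^ n * w ^ m"
proof -
  have "((\<lambda>k. \<gamma> ^ k / fact k * (z ^ n / fact n) * (w ^ m / fact m)) has_sum
          exp \<gamma> * (z ^ n / fact n) * (w ^ m / fact m)) UNIV"
    by (intro has_sum_cmult_left has_sum_exp_series)
  then show ?thesis
    by (simp add: Gould_Hopper_def floor_quot_def infsumI)
qed

lemma exp_partial_0_0: "exp_partial \<gamma> 0 0 f z w = exp \<gamma> * f z w"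
  using has_sum_cmult_left[OF has_sum_exp_series]
  by (simp add: exp_partial_def infsumI)

end

theory Submission
  imports Defs
begin

text \<open>Differentiating \<open>z ^ n * w ^ m\<close> i times in z and j times in w gives falling
  factorials times \<open>z ^ (n - i) * w ^ (m - j)\<close>, or 0 once i > n or j > m
  (\<open>mixed_partial_monomial\<close>). With i = p * k and j = q * k, the operator series and the
  Gould-Hopper sum agree term by term, and the extra terms of the former vanish. Symmetry holds
  because the summand and the index bound are symmetric under the swap.\<close>

lemma deriv_cmult_power_cmult:
  "deriv (\<lambda>x::complex. c * x ^ k * d) z = c * (of_nat k * z ^ (k - 1)) * d"
  by (rule DERIV_imp_deriv) (auto intro!: derivative_eq_intros)

text \<open>Induction step for iterated derivatives of a power. The explicit 0 is needed because
  truncated subtraction would turn the falling factorial into n! for i > n.\<close>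

lemma fact_quotient_step:
  "(if i \<le> n then fact n / fact (n - i) else 0) * (of_nat (n - i) * z ^ (n - i - 1)) =
     (if Suc i \<le> n then fact n / fact (n - Suc i) else (0::complex)) * z ^ (n - Suc i)"
proof (cases "Suc i \<le> n")
  case True
  then obtain d where d: "n = Suc i + d"
    using le_Suc_ex by blast
  have "of_nat (Suc d) \<noteq> (0::complex)"
    by (simp only: of_nat_eq_0_iff)
  then show ?thesis
    unfolding d by (simp add: divide_simps del: of_nat_Suc)
next
  case False
  \<comment> \<open>This includes i = n, where the factor \<open>of_nat (n - i)\<close> kills the
    left side.\<close>
  then have "n - i = 0"
    by simp
  with False show ?thesis
    by simp
qed

text \<open>The arbitrary factor \<open>g w\<close>, constant in z, lets this apply after the
  w-derivatives have been taken.\<close>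

lemma funpow_partial_z_monomial:
  "(partial_z ^^ i) (\<lambda>z w. z ^ n * g w) =
     (\<lambda>z w. (if i \<le> n then fact n / fact (n - i) else 0) * z ^ (n - i) * g w)"
proof (induction i)
  case (Suc i)
  then show ?case
    by (simp only: funpow.simps o_apply partial_z_def deriv_cmult_power_cmult fact_quotient_step)
qed simp

lemma funpow_partial_w_monomial:
  "(partial_w ^^ i) (\<lambda>z w. w ^ m * g z) =
     (\<lambda>z w. (if i \<le> m then fact m / fact (m - i) else 0) * w ^ (m - i) * g z)"
proof (induction i)
  case (Suc i)
  then show ?case
    by (simp only: funpow.simps o_apply partial_w_def deriv_cmult_power_cmult fact_quotient_step)
qed simp

lemma mixed_partial_monomial:
  "(partial_z ^^ i) ((partial_w ^^ j) (\<lambda>z w. z ^ n * w ^ m)) z w =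
     (if i \<le> n \<and> j \<le> m
      then fact n * fact m * (z ^ (n - i) / fact (n - i)) * (w ^ (m - j) / fact (m - j)) else 0)"
proof -
  let ?c = "(if j \<le> m then fact m / fact (m - j) else 0) :: complex"
  have "(partial_w ^^ j) (\<lambda>z w. z ^ n * w ^ m) = (\<lambda>z w. z ^ n * (?c * w ^ (m - j)))"
    using funpow_partial_w_monomial[of j m "\<lambda>z. z ^ n"] by (simp only: mult.commute)
  then show ?thesis
    by (simp add: funpow_partial_z_monomial)
qed

text \<open>For p = 0 both sides are true, so the infinity convention requires no separate case
  later.\<close>

lemma enat_le_floor_quot_iff: "enat k \<le> floor_quot j p \<longleftrightarrow> p * k \<le> j"
  by (simp add: floor_quot_def less_eq_div_iff_mult_less_eq mult.commute)

lemma Gould_Hopper_eq_exp_partial: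
  "Gould_Hopper n m p q z w \<gamma> = exp_partial \<gamma> p q (\<lambda>z w. z ^ n * w ^ m) z w"
  unfolding Gould_Hopper_def exp_partial_def infsum_cmult_right'[symmetric] min.bounded_iff
    enat_le_floor_quot_iff mixed_partial_monomial
  \<comment> \<open>Terms off the index set are 0. No summability is required, so p = q = 0 is
    covered too.\<close>
  by (rule infsum_cong_neutral) (auto simp: mult_ac)

lemma Gould_Hopper_commute: "Gould_Hopper n m p q z w \<gamma> = Gould_Hopper m n q p w z \<gamma>"
  by (simp add: Gould_Hopper_def min.commute mult_ac)

theorem proposition2p1:
  fixes n m p q :: nat and z w \<gamma> :: complex
  shows "Gould_Hopper n m p q z w \<gamma> = exp_partial \<gamma> p q (\<lambda>z w. z ^ n * w ^ m) z w
       \<and> Gould_Hopper n m p q z w \<gamma> = Gould_Hopper m n q p w z \<gamma>"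
  using Gould_Hopper_eq_exp_partial Gould_Hopper_commute by blast

end
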